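(* Let $n\ge 1$. The metric space $(\mathcal{H}(\mathbb{R}^n),h)$ of all non-empty compact subsets of $\mathbb{R}^n$ with the Hausdorff metric $h$ is pathwise connected; that is, for all $A,B\in\mathcal{H}(\mathbb{R}^n)$ there is a continuous function $f:[0,1]\to\mathcal{H}(\mathbb{R}^n)$ with $f(0)=A$ and $f(1)=B$.
   Context: $\mathbb{R}^n$ carries the Euclidean metric $d$. $\mathcal{H}(\mathbb{R}^n)$ is the collection of all non-empty compact subsets of $\mathbb{R}^n$. For $x\in\mathbb{R}^n$ and $A,B\in\mathcal{H}(\mathbb{R}^n)$, put $d(x,B)=\inf_{b\in B}d(x,b)$, $\overline{d}(A,B)=\sup_{a\in A}d(a,B)$, and $h(A,B)=\max\{\overline{d}(A,B),\overline{d}(B,A)\}$ (the Hausdorff metric). $\mathcal{H}(\mathbb{R}^n)$ is given the topology induced by $h$. *)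

theory Defs
  imports "HOL-Analysis.Analysis"
begin

definition nonempty_compacts :: "'a::metric_space set set"
  where "nonempty_compacts = {K. compact K \<and> K \<noteq> {}}"

definition excess :: "'a::metric_space set \<Rightarrow> 'a set \<Rightarrow> real"
  where "excess A B = (SUP a\<in>A. infdist a B)"

text \<open>The locale \<^locale>\<open>Metric_space\<close> requires nonnegativity and symmetry of the
  distance on the whole type, and a supremum of an unbounded set of reals is unspecified;
  hence the value 0 outside the non-empty compact sets.\<close>

definition hausdorff_dist :: "'a::metric_space set \<Rightarrow> 'a set \<Rightarrow> real"
  where "hausdorff_dist A B =
    (if A \<in> nonempty_compacts \<and> B \<in> nonempty_compacts then max (excess A B) (excess B A) else 0)"

lemma bdd_above_infdist_compact:
  assumes "compact A"
  shows "bdd_above ((\<lambda>a. infdist a B) ` A)"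
proof -
  have "compact ((\<lambda>a. infdist a B) ` A)"
    by (intro compact_continuous_image continuous_intros assms)
  then show ?thesis
    by (intro bounded_imp_bdd_above compact_imp_bounded)
qed

lemma excess_le_iff:
  assumes "A \<in> nonempty_compacts"
  shows "excess A B \<le> r \<longleftrightarrow> (\<forall>a\<in>A. infdist a B \<le> r)"
  using assms unfolding excess_def nonempty_compacts_def
  by (auto simp: cSUP_le_iff bdd_above_infdist_compact)

lemma excess_nonneg:
  assumes "A \<in> nonempty_compacts"
  shows "0 \<le> excess A B"
proof -
  obtain a where "a \<in> A" using assms by (auto simp: nonempty_compacts_def)
  moreover have "\<forall>a\<in>A. infdist a B \<le> excess A B"
    using excess_le_iff[OF assms, of B "excess A B"] by simp
  ultimately show ?thesis
    using infdist_nonneg[of a B] by fastforce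
qed

lemma excess_le_0_iff:
  assumes "A \<in> nonempty_compacts" "B \<in> nonempty_compacts"
  shows "excess A B \<le> 0 \<longleftrightarrow> A \<subseteq> B"
proof -
  have B: "closed B" "B \<noteq> {}"
    using assms(2) by (auto simp: nonempty_compacts_def compact_imp_closed)
  have "infdist a B \<le> 0 \<longleftrightarrow> a \<in> B" for a
    using in_closed_iff_infdist_zero[OF B, of a] infdist_nonneg[of a B] by linarith
  then show ?thesis
    by (auto simp: excess_le_iff[OF assms(1)])
qed

lemma excess_triangle:
  assumes "A \<in> nonempty_compacts" "B \<in> nonempty_compacts" "C \<in> nonempty_compacts"
  shows "excess A C \<le> excess A B + excess B C"
  unfolding excess_le_iff[OF assms(1)]
proof
  fix a assume "a \<in> A"
  have B: "B \<noteq> {}" using assms(2) by (simp add: nonempty_compacts_def)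
  have "infdist a C - excess B C \<le> dist a b" if "b \<in> B" for b
  proof -
    have "infdist a C \<le> infdist b C + dist a b"
      by (rule infdist_triangle)
    moreover have "infdist b C \<le> excess B C"
      using excess_le_iff[OF assms(2), of C "excess B C"] that by simp
    ultimately show ?thesis by simp
  qed
  then have "infdist a C - excess B C \<le> infdist a B"
    unfolding infdist_notempty[OF B] by (intro cINF_greatest B)
  also have "\<dots> \<le> excess A B"
    using excess_le_iff[OF assms(1), of B "excess A B"] \<open>a \<in> A\<close> by simp
  finally show "infdist a C \<le> excess A B + excess B C" by simp
qed

lemma Metric_space_hausdorff: "Metric_space nonempty_compacts hausdorff_dist"
proof
  fix A B :: "'a set"
  show "0 \<le> hausdorff_dist A B"
    using excess_nonneg[of A B] by (simp add: hausdorff_dist_def le_max_iff_disj)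
  show "hausdorff_dist A B = hausdorff_dist B A"
    by (simp add: hausdorff_dist_def max.commute)
next
  fix A B :: "'a set"
  assume AB: "A \<in> nonempty_compacts" "B \<in> nonempty_compacts"
  have "hausdorff_dist A B = 0 \<longleftrightarrow> excess A B \<le> 0 \<and> excess B A \<le> 0"
    using AB excess_nonneg[of A B] excess_nonneg[of B A] by (auto simp: hausdorff_dist_def)
  then show "hausdorff_dist A B = 0 \<longleftrightarrow> A = B"
    using AB by (auto simp: excess_le_0_iff)
next
  fix A B C :: "'a set"
  assume "A \<in> nonempty_compacts" "B \<in> nonempty_compacts" "C \<in> nonempty_compacts"
  then show "hausdorff_dist A C \<le> hausdorff_dist A B + hausdorff_dist B C"
    using excess_triangle[of A B C] excess_triangle[of C B A] by (auto simp: hausdorff_dist_def max_def)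
qed

end

theory Submission
  imports Defs
begin

text \<open>The sets \<open>{(1 - t) *\<^sub>R a + t *\<^sub>R b | a \<in> A, b \<in> B}\<close> for \<open>t\<close> in \<open>[0,1]\<close> form a path from
  \<open>A\<close> to \<open>B\<close> that is Lipschitz for the Hausdorff distance: moving the parameter from \<open>s\<close> to \<open>t\<close>
  displaces the point given by \<open>(a, b)\<close> by \<open>\<bar>s - t\<bar> * dist a b\<close>, and \<open>dist\<close> is bounded on \<open>A \<times> B\<close>.\<close>

definition minkowski_segment :: "'a::real_normed_vector set \<Rightarrow> 'a set \<Rightarrow> real \<Rightarrow> 'a set"
  where "minkowski_segment A B t = (\<lambda>(a, b). (1 - t) *\<^sub>R a + t *\<^sub>R b) ` (A \<times> B)"

lemma minkowski_segment_nonempty_compacts: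
  assumes "A \<in> nonempty_compacts" "B \<in> nonempty_compacts"
  shows "minkowski_segment A B t \<in> nonempty_compacts"
proof -
  have "compact (minkowski_segment A B t)"
    unfolding minkowski_segment_def case_prod_beta using assms
    by (intro compact_continuous_image continuous_intros compact_Times)
       (auto simp: nonempty_compacts_def)
  then show ?thesis
    using assms by (auto simp: nonempty_compacts_def minkowski_segment_def)
qed

text \<open>At \<open>t = 0\<close> the pair \<open>(a, b)\<close> contributes \<open>a\<close>, so
  the image is the first projection of \<open>A \<times> B\<close>, which is all of \<open>A\<close>
  because \<open>B\<close> has an element.\<close>

lemma minkowski_segment_0:
  assumes "B \<noteq> {}"
  shows "minkowski_segment A B 0 = A"
  using assms by (auto simp: minkowski_segment_def image_iff)

lemma minkowski_segment_1:
  assumes "A \<noteq> {}"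
  shows "minkowski_segment A B 1 = B"
  using assms by (auto simp: minkowski_segment_def image_iff)

lemma excess_minkowski_segment_le:
  fixes A B :: "'a::real_normed_vector set"
  assumes "A \<in> nonempty_compacts" "B \<in> nonempty_compacts"
    and bound: "\<And>a b. a \<in> A \<Longrightarrow> b \<in> B \<Longrightarrow> dist a b \<le> M"
  shows "excess (minkowski_segment A B s) (minkowski_segment A B t) \<le> \<bar>s - t\<bar> * M"
  unfolding excess_le_iff[OF minkowski_segment_nonempty_compacts[OF assms(1,2)]]
proof
  fix x assume "x \<in> minkowski_segment A B s"
  then obtain a b where ab: "a \<in> A" "b \<in> B" and x: "x = (1 - s) *\<^sub>R a + s *\<^sub>R b"
    by (auto simp: minkowski_segment_def)
  \<comment> \<open>The witness keeps the pair \<open>(a, b)\<close> that produced \<open>x\<close>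
    and changes only the parameter; any point of the second set bounds \<open>infdist\<close> from
    above.\<close>
  let ?y = "(1 - t) *\<^sub>R a + t *\<^sub>R b"
  have "?y \<in> minkowski_segment A B t"
    using ab by (auto simp: minkowski_segment_def)
  then have "infdist x (minkowski_segment A B t) \<le> dist x ?y"
    by (rule infdist_le)
  also have "x - ?y = (t - s) *\<^sub>R (a - b)"
    by (simp add: x algebra_simps)
  then have "dist x ?y = \<bar>s - t\<bar> * dist a b"
    by (simp add: dist_norm abs_minus_commute)
  also have "\<dots> \<le> \<bar>s - t\<bar> * M"
    using ab by (intro mult_left_mono bound) auto
  finally show "infdist x (minkowski_segment A B t) \<le> \<bar>s - t\<bar> * M" .
qed

lemma pathin_minkowski_segment:
  fixes A B :: "'a::real_normed_vector set"
  assumes AB: "A \<in> nonempty_compacts" "B \<in> nonempty_compacts"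
  shows "pathin (Metric_space.mtopology nonempty_compacts hausdorff_dist) (minkowski_segment A B)"
proof -
  interpret H: Metric_space "nonempty_compacts :: 'a set set" hausdorff_dist
    by (rule Metric_space_hausdorff)
  let ?f = "minkowski_segment A B"
  have f: "?f t \<in> nonempty_compacts" for t
    by (rule minkowski_segment_nonempty_compacts[OF AB])
  \<comment> \<open>Distances within a bounded set have a common bound; on the union this covers all
    pairs from \<open>A \<times> B\<close>.\<close>
  have "bounded (A \<union> B)"
    using AB by (simp add: nonempty_compacts_def compact_imp_bounded)
  then obtain M where M: "\<And>a b. a \<in> A \<Longrightarrow> b \<in> B \<Longrightarrow> dist a b \<le> M"
    unfolding bounded_two_points by (meson UnI1 UnI2)
  \<comment> \<open>Exchanging \<open>s\<close> and \<open>t\<close> gives the second excess the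
    same bound. By \<open>f\<close> the distance is the maximum of the two excesses, not the default
    0.\<close>
  have lipschitz: "hausdorff_dist (?f s) (?f t) \<le> \<bar>s - t\<bar> * M" for s t
    using excess_minkowski_segment_le[OF AB M, of s t] excess_minkowski_segment_le[OF AB M, of t s]
    by (simp add: hausdorff_dist_def f abs_minus_commute)
  show ?thesis
    unfolding pathin_def H.continuous_map_to_metric
  proof (intro ballI allI impI)
    fix s \<epsilon> :: real
    assume s: "s \<in> topspace (top_of_set {0..1})" and "0 < \<epsilon>"
    show "\<exists>U. openin (top_of_set {0..1}) U \<and> s \<in> U \<and> (\<forall>t\<in>U. ?f t \<in> H.mball (?f s) \<epsilon>)"
    proof (intro exI conjI ballI)
      \<comment> \<open>A ball of radius \<open>\<epsilon> / M\<close> would break down for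
        \<open>M = 0\<close>, which can occur when \<open>A\<close> and \<open>B\<close> are the
        same singleton. This set avoids the division and is open as the preimage of an open
        ray.\<close>
      let ?U = "{t \<in> {0..1}. \<bar>s - t\<bar> * M < \<epsilon>}"
      have "openin (top_of_set {0..1}) ({0..1} \<inter> (\<lambda>t. \<bar>s - t\<bar> * M) -` {..<\<epsilon>})"
        by (intro continuous_openin_preimage_gen continuous_intros open_lessThan)
      also have "{0..1} \<inter> (\<lambda>t. \<bar>s - t\<bar> * M) -` {..<\<epsilon>} = ?U"
        by auto
      finally show "openin (top_of_set {0..1}) ?U" .
      show "s \<in> ?U"
        using s \<open>0 < \<epsilon>\<close> by simp
      show "?f t \<in> H.mball (?f s) \<epsilon>" if "t \<in> ?U" for t
        using that lipschitz[of s t] by (simp add: f)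
    qed
  qed
qed

theorem theorem2p3p5:
  shows "path_connected_space
    (Metric_space.mtopology (nonempty_compacts :: (real ^ 'n) set set) hausdorff_dist)"
proof -
  interpret H: Metric_space "nonempty_compacts :: (real ^ 'n) set set" hausdorff_dist
    by (rule Metric_space_hausdorff)
  have "\<exists>g. pathin H.mtopology g \<and> g 0 = A \<and> g 1 = B"
    if AB: "A \<in> nonempty_compacts" "B \<in> nonempty_compacts" for A B :: "(real ^ 'n) set"
  proof -
    \<comment> \<open>Each set secures the opposite endpoint: \<open>B \<noteq> {}\<close> gives the
      value \<open>A\<close> at 0, and \<open>A \<noteq> {}\<close> gives \<open>B\<close> at
      1.\<close>
    have "A \<noteq> {}" "B \<noteq> {}"
      using AB by (auto simp: nonempty_compacts_def)
    then show ?thesis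
      using pathin_minkowski_segment[OF AB] minkowski_segment_0[of B A] minkowski_segment_1[of A B]
      by (intro exI[of _ "minkowski_segment A B"] conjI) simp_all
  qed
  then show ?thesis
    by (simp add: path_connected_space_def)
qed

end
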